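(* Let $(w_j)_{j\ge1}$ be random frequencies, i.e. random variables with values in $(0,1)$ such that $\sum_{j\ge1}w_j=1$ almost surely. Conditionally on $(w_j)_{j\ge1}$, let $X_1,X_2,\dots$ be i.i.d. positive-integer-valued random variables with $P(X_i=j\mid (w_\ell)_{\ell\ge1})=w_j$, and let $K_n$ be the number of distinct values among $X_1,\dots,X_n$. Define the tail mean measure $$\overrightarrow\nu(x)=\mathrm{E}\big(\#\{j\ge1:\ w_j\ge x\}\big),\qquad x\in(0,1].$$ Suppose there exist a function $\ell$ that is slowly varying at zero (i.e. $\ell(\lambda x)/\ell(x)\to1$ as $x\to0$ for every $\lambda>0$) and a constant $c\ge 0$ such that for every $\lambda>0$ $$\frac{\overrightarrow\nu(\lambda x)-\overrightarrow\nu(x)}{\ell(x)}\to c\log\lambda\qquad\text{as }x\to0.$$ Then $$\mathrm{E}(K_n)=\overrightarrow\nu(1/n)-c\gamma\,\ell(1/n)+o(\ell(1/n)),\qquad n\to\infty,$$ where $\gamma$ is the Euler–Mascheroni constant.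
   Context: A function $\ell$ is slowly varying at zero if $\ell(\lambda x)/\ell(x)\to 1$ as $x\to 0$ for all $\lambda>0$. The condition on $\overrightarrow\nu$ is de Haan slow variation at zero with auxiliary function $\ell$. (The paper states $c\ge0$, but applies the theorem also with auxiliary functions such as $\ell(x)=(\log x)^{m+1}$ and constants $c$ of either sign.) *)

theory Defs
  imports "HOL-Probability.Probability" "HOL-Library.Landau_Symbols"
begin

text \<open>Frequencies are indexed by j \<ge> 1; w j \<omega> is the j-th frequency at outcome \<omega>.\<close>

definition slowly_varying_at_0 :: "(real \<Rightarrow> real) \<Rightarrow> bool" where
  "slowly_varying_at_0 l \<longleftrightarrow>
     (\<forall>lam>0. ((\<lambda>x. l (lam * x) / l x) \<longlongrightarrow> 1) (at_right 0))"

definition tail_mean_measure :: "'a measure \<Rightarrow> (nat \<Rightarrow> 'a \<Rightarrow> real) \<Rightarrow> real \<Rightarrow> real" where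
  "tail_mean_measure M w x = (\<integral>\<omega>. real (card {j. 1 \<le> j \<and> w j \<omega> \<ge> x}) \<partial>M)"

definition num_distinct :: "(nat \<Rightarrow> 'a \<Rightarrow> nat) \<Rightarrow> nat \<Rightarrow> 'a \<Rightarrow> nat" where
  "num_distinct X n \<omega> = card ((\<lambda>i. X i \<omega>) ` {1..n})"

definition freq_sigma :: "'a measure \<Rightarrow> (nat \<Rightarrow> 'a \<Rightarrow> real) \<Rightarrow> 'a set set" where
  "freq_sigma M w = sigma_sets (space M) {w j -` B \<inter> space M | j B. 1 \<le> j \<and> B \<in> sets borel}"

end

theory Submission
  imports Defs
begin

text \<open>
  Write \<open>\<nu>\<close> for the tail mean measure. Since \<open>P(j \<notin> {X\<^sub>1, \<dots>, X\<^sub>n}) = E (1 - w\<^sub>j)\<^sup>n\<close>, Tonelli gives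
  \<open>E K\<^sub>n = \<integral>\<^sub>0\<^sup>n (1 - y/n)\<^bsup>n-1\<^esup> \<nu>(y/n) dy\<close>. The kernel has mass \<open>1\<close> and its integral against
  \<open>ln y\<close> is \<open>ln n - H\<^sub>n\<close>, which tends to \<open>-\<gamma>\<close>. So it suffices that the integral of the kernel against
  \<open>(\<nu>(y/n) - \<nu>(1/n)) / \<ell>(1/n) - c ln y\<close> tends to \<open>0\<close>, by dominated convergence.

  As \<open>\<ell>\<close> is not assumed measurable, the uniform convergence theorem is not available. The
  dominating bound \<open>\<bar>\<nu>(y x) - \<nu>(x)\<bar> \<le> C (\<surd>y + 1/\<surd>y) \<bar>\<ell>(x)\<bar>\<close> uses slow variation along factors of \<open>2\<close>
  only, the monotonicity of \<open>\<nu>\<close> to interpolate, and \<open>\<nu>(x) \<rightarrow> \<infinity>\<close> as \<open>x \<rightarrow> 0\<close> when \<open>y x\<close> is not small.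
\<close>

section \<open>Global bounds from de Haan slow variation\<close>

text \<open>Halving the argument multiplies \<open>g\<close> by at most 6/5 but
  \<open>1 / sqrt y\<close> by \<open>sqrt 2 > 6/5\<close>, so the dyadic increments of
  \<open>nu\<close> add up to a constant multiple of \<open>D * g x / sqrt y\<close>. Monotonicity
  covers factors between two powers of 2.\<close>

lemma antitone_dyadic_growth_below:
  fixes nu g :: "real \<Rightarrow> real"
  assumes mono: "\<And>x y. 0 < x \<Longrightarrow> x \<le> y \<Longrightarrow> nu y \<le> nu x"
    and D: "0 \<le> D" and g0: "\<And>x. 0 \<le> g x"
    and g: "\<And>x. 0 < x \<Longrightarrow> x < d \<Longrightarrow> g (x / 2) \<le> 6/5 * g x"
    and nu: "\<And>x. 0 < x \<Longrightarrow> x < d \<Longrightarrow> nu (x / 2) - nu x \<le> D * g x"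
    and y: "0 < y" "y \<le> 1" and x: "0 < x" "x < d"
  shows "nu (y * x) - nu x \<le> 10 * D * g x / sqrt y"
proof -
  obtain k :: nat where "(1/2) ^ k < y"
    using real_arch_pow_inv[of y "1/2"] y by auto
  \<comment> \<open>Both \<open>x\<close> and \<open>y\<close> are generalised because the recursion
    reads \<open>y * x\<close> as \<open>(2 * y) * (x / 2)\<close>.\<close>
  moreover have "\<lbrakk>(1/2) ^ k \<le> y; y \<le> 1; 0 < x; x < d\<rbrakk> \<Longrightarrow> nu (y * x) - nu x \<le> 10 * D * g x / sqrt y" for y x
  proof (induction k arbitrary: x y)
    case 0
    then show ?case using D g0[of x] by simp
  next
    case (Suc k)
    have y0: "0 < y" using Suc.prems(1) by (smt (verit) zero_less_power half_gt_zero)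
    have s: "sqrt y \<le> 1" "0 < sqrt y" using Suc.prems y0 by auto
    have one: "D * g x \<le> D * g x / sqrt y"
      using s D g0[of x] by (simp add: le_divide_eq mult_left_le)
    show ?case
    proof (cases "1/2 \<le> y")
      case True
      have "nu (y * x) \<le> nu (x / 2)"
        using mono[of "x / 2" "y * x"] mult_right_mono[OF True, of x] Suc.prems by simp
      then have "nu (y * x) - nu x \<le> D * g x / sqrt y" using nu[of x] Suc.prems one by linarith
      also have "\<dots> \<le> 10 * D * g x / sqrt y"
        using s D g0[of x] by (intro divide_right_mono) (auto simp: mult_right_mono)
      finally show ?thesis .
    next
      case False
      have "nu ((2 * y) * (x / 2)) - nu (x / 2) \<le> 10 * D * g (x / 2) / sqrt (2 * y)"
        using Suc.prems False by (intro Suc.IH) auto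
      also have "\<dots> \<le> 10 * D * (6/5 * g x) / sqrt (2 * y)"
        using g[of x] Suc.prems D y0 by (intro divide_right_mono mult_left_mono) auto
      \<comment> \<open>The constant 10 reproduces itself: \<open>10 * (6/5) / sqrt 2\<close> is at
        most 9, and the remaining step from \<open>x / 2\<close> to \<open>x\<close> adds at most
        one unit \<open>D * g x / sqrt y\<close>.\<close>
      also have "\<dots> = (12 / sqrt 2) * (D * g x / sqrt y)"
        by (simp add: real_sqrt_mult)
      also have "\<dots> \<le> 9 * (D * g x / sqrt y)"
      proof (rule mult_right_mono)
        have "4/3 \<le> sqrt 2" by (rule real_le_rsqrt) (simp add: power2_eq_square)
        then show "12 / sqrt 2 \<le> 9" by (simp add: divide_le_eq)
      qed (use D g0 s in auto)
      finally show ?thesis using one nu[of x] Suc.prems by simp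
    qed
  qed
  ultimately show ?thesis using assms by (meson less_imp_le)
qed

text \<open>Mirror image with doubling in place of halving and \<open>sqrt y\<close> in place of
  \<open>1 / sqrt y\<close>. The condition \<open>y * x < d\<close> keeps the dyadic chain from
  \<open>x\<close> up to \<open>y * x\<close> inside the range where the one-step estimates
  hold.\<close>

lemma antitone_dyadic_growth_above:
  fixes nu g :: "real \<Rightarrow> real"
  assumes mono: "\<And>x y. 0 < x \<Longrightarrow> x \<le> y \<Longrightarrow> nu y \<le> nu x"
    and D: "0 \<le> D" and g0: "\<And>x. 0 \<le> g x"
    and g: "\<And>x. 0 < x \<Longrightarrow> x < d \<Longrightarrow> g (2 * x) \<le> 6/5 * g x"
    and nu: "\<And>x. 0 < x \<Longrightarrow> x < d \<Longrightarrow> nu x - nu (2 * x) \<le> D * g x"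
    and y: "1 \<le> y" and x: "0 < x" "y * x < d"
  shows "nu x - nu (y * x) \<le> 10 * D * g x * sqrt y"
proof -
  obtain k :: nat where "y < 2 ^ k"
    using real_arch_pow[of 2 y] by auto
  moreover have "\<lbrakk>y \<le> 2 ^ k; 1 \<le> y; 0 < x; y * x < d\<rbrakk> \<Longrightarrow> nu x - nu (y * x) \<le> 10 * D * g x * sqrt y" for y x
  proof (induction k arbitrary: x y)
    case 0
    then show ?case using D g0[of x] by simp
  next
    case (Suc k)
    have s: "1 \<le> sqrt y" using Suc.prems by auto
    have one: "D * g x \<le> D * g x * sqrt y"
      using mult_left_mono[OF s, of "D * g x"] D g0[of x] by simp
    have xd: "x < d" using Suc.prems mult_right_mono[of 1 y x] by linarith
    show ?case
    proof (cases "y \<le> 2")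
      case True
      have "nu (2 * x) \<le> nu (y * x)"
        using Suc.prems True by (intro mono) auto
      then have "nu x - nu (y * x) \<le> D * g x * sqrt y" using nu[of x] Suc.prems one xd by linarith
      also have "\<dots> \<le> 10 * D * g x * sqrt y"
        using s D g0[of x] by (intro mult_right_mono) auto
      finally show ?thesis .
    next
      case False
      have "nu (2 * x) - nu ((y / 2) * (2 * x)) \<le> 10 * D * g (2 * x) * sqrt (y / 2)"
        using Suc.prems False by (intro Suc.IH) auto
      also have "\<dots> \<le> 10 * D * (6/5 * g x) * sqrt (y / 2)"
        using g[of x] Suc.prems D xd by (intro mult_right_mono mult_left_mono) auto
      also have "\<dots> = (12 / sqrt 2) * (D * g x * sqrt y)"
        by (simp add: real_sqrt_divide)
      also have "\<dots> \<le> 9 * (D * g x * sqrt y)"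
      proof (rule mult_right_mono)
        have "4/3 \<le> sqrt 2" by (rule real_le_rsqrt) (simp add: power2_eq_square)
        then show "12 / sqrt 2 \<le> 9" by (simp add: divide_le_eq)
      qed (use D g0 s in auto)
      finally show ?thesis using one nu[of x] Suc.prems xd by simp
    qed
  qed
  ultimately show ?thesis using assms by (meson less_imp_le)
qed

section \<open>A bound uniform in the dilation factor\<close>

lemma slowly_varying_at_0_nonzero:
  assumes "slowly_varying_at_0 l"
  shows "eventually (\<lambda>x. l x \<noteq> 0) (at_right 0)"
proof -
  have "((\<lambda>x. l (1 * x) / l x) \<longlongrightarrow> 1) (at_right 0)"
    using assms unfolding slowly_varying_at_0_def by (metis zero_less_one)
  \<comment> \<open>A zero denominator gives the quotient 0 by convention, so positivity of
    \<open>l (1 * x) / l x\<close> forces \<open>l x \<noteq> 0\<close>.\<close>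
  then have "eventually (\<lambda>x. l (1 * x) / l x > 0) (at_right 0)"
    by (rule order_tendstoD) simp
  then show ?thesis by eventually_elim auto
qed

lemma slowly_varying_at_0_abs_le:
  assumes "slowly_varying_at_0 l" "0 < a" "1 < r"
  shows "eventually (\<lambda>x. \<bar>l (a * x)\<bar> \<le> r * \<bar>l x\<bar>) (at_right 0)"
proof -
  have "((\<lambda>x. \<bar>l (a * x) / l x\<bar>) \<longlongrightarrow> \<bar>1\<bar>) (at_right 0)"
    using assms unfolding slowly_varying_at_0_def by (intro tendsto_rabs) auto
  then have "eventually (\<lambda>x. \<bar>l (a * x) / l x\<bar> < r) (at_right 0)"
    using assms(3) by (intro order_tendstoD) auto
  with slowly_varying_at_0_nonzero[OF assms(1)] show ?thesis
    by eventually_elim (auto simp: field_simps)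
qed

lemma tendsto_quotient_bounded:
  fixes f g :: "real \<Rightarrow> real"
  assumes "((\<lambda>x. f x / g x) \<longlongrightarrow> L) F" "eventually (\<lambda>x. g x \<noteq> 0) F"
  shows "eventually (\<lambda>x. \<bar>f x\<bar> \<le> (\<bar>L\<bar> + 1) * \<bar>g x\<bar>) F"
proof -
  have "eventually (\<lambda>x. \<bar>f x / g x\<bar> < \<bar>L\<bar> + 1) F"
    using tendsto_rabs[OF assms(1)] by (rule order_tendstoD) simp
  with assms(2) show ?thesis by eventually_elim (auto simp: field_simps)
qed

text \<open>A Potter-type bound for the increments. The weight \<open>1 / sqrt y\<close> is
  integrable at 0 and \<open>sqrt y\<close> is harmless against exponential decay; the exponent 1/2
  asks of slow variation only a growth factor below \<open>sqrt 2\<close> per dyadic step.\<close>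

lemma de_haan_global_bound:
  fixes nu l :: "real \<Rightarrow> real"
  assumes mono: "\<And>x y. 0 < x \<Longrightarrow> x \<le> y \<Longrightarrow> nu y \<le> nu x"
    and nonneg: "\<And>x. 0 < x \<Longrightarrow> 0 \<le> nu x"
    and top: "filterlim nu at_top (at_right 0)"
    and sv: "slowly_varying_at_0 l"
    and dH: "\<forall>lam>0. ((\<lambda>x. (nu (lam * x) - nu x) / l x) \<longlongrightarrow> c * ln lam) (at_right 0)"
  obtains C where "0 \<le> C"
    "eventually (\<lambda>x. \<forall>y>0. \<bar>nu (y * x) - nu x\<bar> \<le> C * (sqrt y + 1 / sqrt y) * \<bar>l x\<bar>) (at_right 0)"
proof -
  \<comment> \<open>Near 0 each de Haan quotient is at most its limit in absolute value plus 1;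
    \<open>D\<close> serves for both dilation factors 2 and 1/2.\<close>
  define D where "D = \<bar>c * ln 2\<bar> + \<bar>c * ln (1/2)\<bar> + 1"
  have D: "0 \<le> D" "\<bar>c * ln 2\<bar> + 1 \<le> D" "\<bar>c * ln (1/2)\<bar> + 1 \<le> D" unfolding D_def by auto
  note nz = slowly_varying_at_0_nonzero[OF sv]
  have lims: "((\<lambda>x. (nu (2 * x) - nu x) / l x) \<longlongrightarrow> c * ln 2) (at_right 0)"
    "((\<lambda>x. (nu (1/2 * x) - nu x) / l x) \<longlongrightarrow> c * ln (1/2)) (at_right 0)"
    using dH by (metis zero_less_numeral, metis half_gt_zero zero_less_one)
  have "eventually (\<lambda>x. \<bar>l (2 * x)\<bar> \<le> 6/5 * \<bar>l x\<bar> \<and> \<bar>l (1/2 * x)\<bar> \<le> 6/5 * \<bar>l x\<bar>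
     \<and> \<bar>nu (2 * x) - nu x\<bar> \<le> (\<bar>c * ln 2\<bar> + 1) * \<bar>l x\<bar>
     \<and> \<bar>nu (1/2 * x) - nu x\<bar> \<le> (\<bar>c * ln (1/2)\<bar> + 1) * \<bar>l x\<bar>) (at_right 0)"
    using tendsto_quotient_bounded[OF lims(1) nz] tendsto_quotient_bounded[OF lims(2) nz]
    by (intro eventually_conj slowly_varying_at_0_abs_le sv) auto
  then obtain d where d: "0 < d" and ev: "\<And>x. 0 < x \<Longrightarrow> x < d \<Longrightarrow> \<bar>l (2 * x)\<bar> \<le> 6/5 * \<bar>l x\<bar> \<and> \<bar>l (1/2 * x)\<bar> \<le> 6/5 * \<bar>l x\<bar>
     \<and> \<bar>nu (2 * x) - nu x\<bar> \<le> (\<bar>c * ln 2\<bar> + 1) * \<bar>l x\<bar>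
     \<and> \<bar>nu (1/2 * x) - nu x\<bar> \<le> (\<bar>c * ln (1/2)\<bar> + 1) * \<bar>l x\<bar>"
    unfolding eventually_at_right_field by blast
  have g: "\<bar>l (2 * x)\<bar> \<le> 6/5 * \<bar>l x\<bar>" "\<bar>l (x / 2)\<bar> \<le> 6/5 * \<bar>l x\<bar>"
      "nu x - nu (2 * x) \<le> D * \<bar>l x\<bar>" "nu (x / 2) - nu x \<le> D * \<bar>l x\<bar>"
    if "0 < x" "x < d" for x
  proof -
    have "x / 2 = 1/2 * x" by simp
    note e = ev[OF that, folded this] mult_right_mono[OF D(2), of "\<bar>l x\<bar>"] mult_right_mono[OF D(3), of "\<bar>l x\<bar>"]
    show "\<bar>l (2 * x)\<bar> \<le> 6/5 * \<bar>l x\<bar>" "\<bar>l (x / 2)\<bar> \<le> 6/5 * \<bar>l x\<bar>" using e by blast+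
    show "nu x - nu (2 * x) \<le> D * \<bar>l x\<bar>" "nu (x / 2) - nu x \<le> D * \<bar>l x\<bar>"
      using e by (linarith, linarith)
  qed
  have below: "nu (y * x) - nu x \<le> 10 * D * \<bar>l x\<bar> / sqrt y" if "0 < y" "y \<le> 1" "0 < x" "x < d" for x y
    using that antitone_dyadic_growth_below[of nu D "\<lambda>x. \<bar>l x\<bar>" d y x] mono D(1) g by simp
  have above: "nu x - nu (y * x) \<le> 10 * D * \<bar>l x\<bar> * sqrt y" if "1 \<le> y" "0 < x" "y * x < d" for x y
    using that antitone_dyadic_growth_above[of nu D "\<lambda>x. \<bar>l x\<bar>" d y x] mono D(1) g by simp
  have "eventually (\<lambda>x. 2 * nu (d / 2) \<le> nu x) (at_right 0)"
    using top by (simp add: filterlim_at_top)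
  moreover have "eventually (\<lambda>x::real. x \<in> {0<..<d/2}) (at_right 0)"
    using d by (intro eventually_at_right_real) simp
  ultimately have "eventually (\<lambda>x. \<forall>y>0. \<bar>nu (y * x) - nu x\<bar> \<le> (20 * D) * (sqrt y + 1 / sqrt y) * \<bar>l x\<bar>) (at_right 0)"
  proof eventually_elim
    case (elim x)
    then have x: "0 < x" "x < d / 2" by auto
    show ?case
    proof (intro allI impI)
      fix y :: real assume y: "0 < y"
      consider "y \<le> 1" | "1 \<le> y" "y * x < d" | "1 \<le> y" "d \<le> y * x" by linarith
      then show "\<bar>nu (y * x) - nu x\<bar> \<le> (20 * D) * (sqrt y + 1 / sqrt y) * \<bar>l x\<bar>"
      proof cases
        case 1
        have "nu x \<le> nu (y * x)" using x y 1 by (intro mono) auto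
        then have "\<bar>nu (y * x) - nu x\<bar> \<le> 10 * D * \<bar>l x\<bar> * (1 / sqrt y)" using below[of y x] x y d 1 by simp
        also have "\<dots> \<le> 20 * D * \<bar>l x\<bar> * (sqrt y + 1 / sqrt y)"
          using D(1) y by (intro mult_mono) auto
        finally show ?thesis by (simp add: mult_ac)
      next
        case 2
        have "nu (y * x) \<le> nu x" using x y 2 by (intro mono) auto
        then have "\<bar>nu (y * x) - nu x\<bar> \<le> 10 * D * \<bar>l x\<bar> * sqrt y" using above[of y x] x y 2 by simp
        also have "\<dots> \<le> 20 * D * \<bar>l x\<bar> * (sqrt y + 1 / sqrt y)"
          using D(1) y by (intro mult_mono) auto
        finally show ?thesis by (simp add: mult_ac)
      next
        case 3
        have "nu (y * x) \<le> nu x" using x y 3 by (intro mono) auto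
        moreover have "0 \<le> nu (y * x)" using nonneg x y by simp
        \<comment> \<open>Here \<open>y * x\<close> lies beyond the reach of the dyadic estimates.
          As \<open>nu (y * x) \<ge> 0\<close>, the difference is at most \<open>nu x\<close>, and
          \<open>2 * nu (d / 2) \<le> nu x\<close> bounds this by twice the increment between
          \<open>x\<close> and \<open>d / 2\<close>, which is within reach. This doubling turns 10
          into 20.\<close>
        ultimately have "\<bar>nu (y * x) - nu x\<bar> \<le> 2 * (nu x - nu ((d / (2 * x)) * x))"
          using elim x by simp
        also have "\<dots> \<le> 2 * (10 * D * \<bar>l x\<bar> * sqrt (d / (2 * x)))"
          using x d by (intro mult_left_mono above) (auto simp: field_simps)
        also have "\<dots> \<le> 2 * (10 * D * \<bar>l x\<bar> * sqrt y)"
          using x d 3 D(1) by (intro mult_left_mono real_sqrt_le_mono) (auto simp: field_simps)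
        also have "\<dots> = 20 * D * \<bar>l x\<bar> * sqrt y" by simp
        also have "\<dots> \<le> 20 * D * \<bar>l x\<bar> * (sqrt y + 1 / sqrt y)"
          using D(1) y by (intro mult_mono) auto
        finally show ?thesis by (simp add: mult_ac)
      qed
    qed
  qed
  with that[of "20 * D"] D(1) show ?thesis by simp
qed

section \<open>The occupancy kernel\<close>

text \<open>For positive \<open>n\<close>, the density of \<open>n\<close> times the minimum of
  \<open>n\<close> independent uniform variables on (0,1), extended by 0 to the real line.\<close>

definition occupancy_kernel :: "nat \<Rightarrow> real \<Rightarrow> real" where
  "occupancy_kernel n y = (if 0 < y \<and> y < real n then (1 - y / real n) ^ (n - 1) else 0)"

lemma occupancy_kernel_measurable [measurable]: "occupancy_kernel n \<in> borel_measurable borel"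
  unfolding occupancy_kernel_def by measurable

lemma occupancy_kernel_nonneg [simp]: "0 \<le> occupancy_kernel n y"
  unfolding occupancy_kernel_def by auto

text \<open>From \<open>1 - t \<le> exp (- t)\<close> and \<open>(n - 1) / n \<ge> 1/2\<close>. The
  bound is free of \<open>n\<close>, as dominated convergence requires.\<close>

lemma occupancy_kernel_le_exp:
  assumes "2 \<le> n"
  shows "occupancy_kernel n y \<le> exp (- y / 2)"
proof (cases "0 < y \<and> y < real n")
  case True
  have "1 - y / real n \<le> exp (- (y / real n))" using exp_ge_add_one_self[of "- (y / real n)"] by simp
  then have "occupancy_kernel n y \<le> exp (- (y / real n)) ^ (n - 1)"
    using True by (auto simp: occupancy_kernel_def intro!: power_mono)
  also have "\<dots> = exp (- (y * (real (n - 1) / real n)))"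
    by (subst exp_of_nat_mult[symmetric]) (simp add: field_simps)
  also have "\<dots> \<le> exp (- (y / 2))"
  proof -
    have "1/2 \<le> real (n - 1) / real n" using assms by (simp add: field_simps of_nat_diff)
    then have "y * (1/2) \<le> y * (real (n - 1) / real n)" using True by (intro mult_left_mono) auto
    then show ?thesis by simp
  qed
  finally show ?thesis by simp
qed (auto simp: occupancy_kernel_def)

text \<open>An antiderivative is \<open>- ((1 - y / n) ^ n)\<close>. Taking \<open>a = n\<close>
  gives total mass 1; taking \<open>a = n * p\<close> gives the probability that a value of
  frequency \<open>p\<close> occurs among \<open>n\<close> draws.\<close>

lemma has_bochner_integral_occupancy_kernel_atMost:
  assumes "0 < n" "0 \<le> a" "a \<le> real n"
  shows "has_bochner_integral lborel (\<lambda>y. occupancy_kernel n y * indicator {..a} y) (1 - (1 - a / real n) ^ n)"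
proof -
  have "has_bochner_integral lborel (\<lambda>y. (1 - y / real n) ^ (n - 1) * indicator {0..a} y)
          (- ((1 - a / real n) ^ n) - (- ((1 - 0 / real n) ^ n)))"
  proof (rule has_bochner_integral_FTC_Icc_nonneg[where F="\<lambda>y. - ((1 - y / real n) ^ n)"])
    show "((\<lambda>y. - ((1 - y / real n) ^ n)) has_real_derivative (1 - y / real n) ^ (n - 1)) (at y)"
      if "y \<in> {0..a}" for y
      using assms by (auto intro!: derivative_eq_intros)
    show "0 \<le> (1 - y / real n) ^ (n - 1)" if "y \<in> {0..a}" for y
      using assms that by simp
  qed (use assms in auto)
  \<comment> \<open>The two integrands can differ only at the null points 0 and
    \<open>n\<close>.\<close>
  moreover have "AE y in lborel. (1 - y / real n) ^ (n - 1) * indicator {0..a} y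
      = occupancy_kernel n y * indicator {..a} y"
    using AE_lborel_singleton[of 0] AE_lborel_singleton[of "real n"]
    by eventually_elim (use assms in \<open>auto simp: occupancy_kernel_def indicator_def\<close>)
  ultimately show ?thesis
    by (subst has_bochner_integral_cong_AE[symmetric]) (auto simp: assms)
qed

section \<open>Integrable majorant and logarithmic moment of the kernel\<close>

lemma powr_exp_integrable:
  fixes a b :: real
  assumes "-1 < a" "0 < b"
  shows "integrable lborel (\<lambda>y. indicator {0<..} y * (y powr a * exp (- b * y)))"
proof -
  \<comment> \<open>Euler's integral for the Gamma function at \<open>a + 1\<close>. Norms turn the
    complex integrand into the real one, and Borel measurability allows the passage from Lebesgue
    measure back to \<open>lborel\<close>.\<close>
  have "(\<lambda>t. complex_of_real t powr (of_real (a + 1) - 1) / of_real (exp (b * t))) absolutely_integrable_on {0<..}"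
    using assms by (intro absolutely_integrable_Gamma_integral) auto
  then have "set_integrable lebesgue {0<..} (\<lambda>t. norm (complex_of_real t powr (of_real (a + 1) - 1) / of_real (exp (b * t))))"
    by (rule absolutely_integrable_norm[unfolded o_def])
  then have "integrable lebesgue (\<lambda>y. indicator {0<..} y * (y powr a * exp (- b * y)))"
    unfolding set_integrable_def
    by (rule Bochner_Integration.integrable_cong[THEN iffD1, rotated -1])
       (auto simp: indicator_def norm_divide norm_powr_real_powr exp_minus field_simps)
  then show ?thesis by (subst (asm) integrable_completion) auto
qed

text \<open>Apply \<open>ln t \<le> t\<close> at \<open>sqrt y\<close> and at
  \<open>1 / sqrt y\<close>, whose logarithms are half of \<open>ln y\<close> and of
  \<open>- ln y\<close>. This puts the logarithm under the same weight as the de Haan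
  increments.\<close>

lemma abs_ln_le_sqrt:
  fixes y :: real
  assumes "0 < y"
  shows "\<bar>ln y\<bar> \<le> 2 * (sqrt y + 1 / sqrt y)"
proof -
  have "ln (sqrt y) \<le> sqrt y" "ln (1 / sqrt y) \<le> 1 / sqrt y"
    using assms by (intro ln_bound; simp)+
  moreover have "ln (sqrt y) = ln y / 2" "ln (1 / sqrt y) = - ln y / 2"
    using assms by (auto simp: ln_sqrt ln_div)
  ultimately have "ln y \<le> 2 * sqrt y" "- ln y \<le> 2 * (1 / sqrt y)" by linarith+
  moreover have "0 < sqrt y" "0 < 1 / sqrt y" using assms by auto
  ultimately show ?thesis unfolding abs_le_iff distrib_left by linarith
qed

text \<open>The majorant, independent of \<open>n \<ge> 2\<close>, for the kernel times a function
  of size \<open>sqrt y + 1 / sqrt y\<close>.\<close>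

definition sqrt_envelope :: "real \<Rightarrow> real" where
  "sqrt_envelope y = indicator {0<..} y * ((sqrt y + 1 / sqrt y) * exp (- y / 2))"

lemma sqrt_envelope_integrable: "integrable lborel sqrt_envelope"
proof -
  have "integrable lborel (\<lambda>y::real. indicator {0<..} y * (y powr (1/2) * exp (- (1/2) * y))
          + indicator {0<..} y * (y powr (-1/2) * exp (- (1/2) * y)))"
    by (intro Bochner_Integration.integrable_add powr_exp_integrable) auto
  then show ?thesis
    by (rule Bochner_Integration.integrable_cong[THEN iffD1, rotated -1])
      (auto simp: sqrt_envelope_def indicator_def powr_half_sqrt powr_minus_divide field_simps)
qed

lemma occupancy_kernel_times_le:
  assumes "2 \<le> n" "0 \<le> C" "\<And>y. 0 < y \<Longrightarrow> \<bar>f y\<bar> \<le> C * (sqrt y + 1 / sqrt y)"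
  shows "\<bar>occupancy_kernel n y * f y\<bar> \<le> C * sqrt_envelope y"
proof (cases "0 < y")
  case True
  have "\<bar>occupancy_kernel n y * f y\<bar> = occupancy_kernel n y * \<bar>f y\<bar>" by (simp add: abs_mult)
  also have "\<dots> \<le> exp (- y / 2) * (C * (sqrt y + 1 / sqrt y))"
    using assms True by (intro mult_mono occupancy_kernel_le_exp) auto
  finally show ?thesis using True by (simp add: sqrt_envelope_def mult_ac)
qed (simp add: occupancy_kernel_def sqrt_envelope_def)

lemma tendsto_x_ln_x: "((\<lambda>x::real. x * ln x) \<longlongrightarrow> 0) (at_right 0)"
proof -
  have "((\<lambda>x::real. ln x / x) \<longlongrightarrow> 0) at_top" by (rule ln_x_over_x_tendsto_0)
  then have "((\<lambda>x::real. ln (inverse x) / inverse x) \<longlongrightarrow> 0) (at_right 0)"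
    by (simp add: filterlim_at_top_to_right)
  then have "((\<lambda>x::real. - (ln (inverse x) / inverse x)) \<longlongrightarrow> - 0) (at_right 0)"
    by (rule tendsto_minus)
  then have "((\<lambda>x::real. - (ln (inverse x) / inverse x)) \<longlongrightarrow> 0) (at_right 0)" by simp
  then show ?thesis
    by (rule Lim_transform_eventually)
       (auto simp: eventually_at_right_field ln_inverse ln_div field_simps intro!: exI[of _ 1])
qed

text \<open>Integration by parts with \<open>1 - (1 - y / n) ^ n\<close>, which vanishes at 0 and so
  absorbs the singularity of the logarithm. The boundary term is \<open>ln n\<close>; the remaining
  integrand is a geometric sum, whose terms integrate to those of \<open>harm n\<close>.\<close>

lemma occupancy_kernel_ln_integral:
  assumes n: "2 \<le> n"
  shows "(\<integral>y. occupancy_kernel n y * ln y \<partial>lborel) = ln (real n) - harm n"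
    and "integrable lborel (\<lambda>y. occupancy_kernel n y * ln y)"
proof -
  show int: "integrable lborel (\<lambda>y. occupancy_kernel n y * ln y)"
  proof (rule Bochner_Integration.integrable_bound)
    show "integrable lborel (\<lambda>y. 2 * sqrt_envelope y)" using sqrt_envelope_integrable by simp
    show "AE y in lborel. norm (occupancy_kernel n y * ln y) \<le> norm (2 * sqrt_envelope y)"
      using occupancy_kernel_times_le[OF n _ abs_ln_le_sqrt]
      by (intro AE_I2) (force intro: order_trans[OF _ abs_ge_self])
  qed measurable
  \<comment> \<open>The antiderivative found by parts, with
    \<open>(1 - (1 - y / n) ^ n) * ln y\<close> rewritten through the geometric sum so that
    continuity at 0 reduces to that of \<open>y * ln y\<close>.\<close>
  define G where "G y = (\<Sum>k<n. (1 - y / real n) ^ k) / real n * (y * ln y)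
      + (\<Sum>k<n. (1 - y / real n) ^ Suc k / real (Suc k))" for y :: real
  have geo: "(\<Sum>k<n. (1 - y / real n) ^ k) = (1 - (1 - y / real n) ^ n) * real n / y" if "0 < y" for y
    using that n by (subst sum_gp_strict) (auto simp: field_simps)
  have "((\<lambda>y. (1 - y / real n) ^ (n - 1) * ln y) has_integral G (real n) - G 0) {0..real n}"
  proof (rule fundamental_theorem_of_calculus_interior)
    have "continuous_on {0..} (\<lambda>y::real. y * ln y)"
      unfolding continuous_on_def
    proof
      fix x :: real assume "x \<in> {0..}"
      then show "((\<lambda>y::real. y * ln y) \<longlongrightarrow> x * ln x) (at x within {0..})"
      proof (cases "x = 0")
        case True
        then show ?thesis using tendsto_x_ln_x by (simp add: at_within_Ici_at_right)
      next
        case False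
        then show ?thesis by (intro tendsto_intros) auto
      qed
    qed
    then have "continuous_on {0..real n} (\<lambda>y::real. y * ln y)" by (rule continuous_on_subset) auto
    then show "continuous_on {0..real n} G"
      unfolding G_def using n by (intro continuous_on_add continuous_on_mult[of _ _ "\<lambda>y. y * ln y"]) (auto intro!: continuous_intros)
    fix y assume y: "y \<in> {0<..<real n}"
    \<comment> \<open>On the open interval \<open>G\<close> equals \<open>?H\<close>, which is
      easier to differentiate: the geometric sum cancels the term with \<open>1 / y\<close>.\<close>
    let ?H = "\<lambda>y. (1 - (1 - y / real n) ^ n) * ln y + (\<Sum>k<n. (1 - y / real n) ^ Suc k / real (Suc k))"
    have "(?H has_real_derivative (1 - y / real n) ^ (n - 1) * ln y) (at y)"
    proof -
      have "(?H has_real_derivative (- (real n * (1 - y / real n) ^ (n - 1) * (- 1 / real n))) * ln y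
         + (1 - (1 - y / real n) ^ n) * (1 / y) + (\<Sum>k<n. (1 - y / real n) ^ k * (- 1 / real n))) (at y)"
        using y n by (auto intro!: derivative_eq_intros sum.cong simp del: power_Suc)
      moreover have "(\<Sum>k<n. (1 - y / real n) ^ k * (- 1 / real n)) = - ((1 - (1 - y / real n) ^ n) * (1 / y))"
        using geo[of y] y n by (simp add: sum_distrib_right[symmetric] sum_divide_distrib[symmetric] sum_negf)
      ultimately show ?thesis using n by simp
    qed
    then have "(G has_real_derivative (1 - y / real n) ^ (n - 1) * ln y) (at y)"
      by (rule DERIV_cong_ev[OF refl _ refl, THEN iffD1, rotated])
         (use y n in \<open>auto simp: G_def geo eventually_nhds intro!: exI[of _ "{0<..<real n}"]\<close>)
    then show "(G has_vector_derivative (1 - y / real n) ^ (n - 1) * ln y) (at y)"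
      by (simp add: has_real_derivative_iff_has_vector_derivative)
  qed simp
  moreover have "G (real n) = ln (real n)" using n by (simp add: G_def sum_gp_strict)
  moreover have "G 0 = harm n"
    by (simp add: G_def harm_def inverse_eq_divide sum.atLeast1_atMost_eq)
  ultimately have "((\<lambda>y. (1 - y / real n) ^ (n - 1) * ln y) has_integral ln (real n) - harm n) {0<..<real n}"
    by (simp add: has_integral_Icc_iff_Ioo)
  then have "((\<lambda>y. occupancy_kernel n y * ln y) has_integral ln (real n) - harm n) UNIV"
    by (subst (asm) has_integral_restrict_UNIV[symmetric])
       (rule has_integral_cong[THEN iffD1, rotated], assumption, auto simp: occupancy_kernel_def)
  with has_integral_integral_lborel[OF int]
  show "(\<integral>y. occupancy_kernel n y * ln y \<partial>lborel) = ln (real n) - harm n"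
    by (rule has_integral_unique)
qed

section \<open>Abelian theorem for the kernel integral\<close>

theorem de_haan_abelian_occupancy:
  fixes nu l :: "real \<Rightarrow> real"
  assumes [measurable]: "nu \<in> borel_measurable borel"
    and mono: "\<And>x y. 0 < x \<Longrightarrow> x \<le> y \<Longrightarrow> nu y \<le> nu x"
    and nonneg: "\<And>x. 0 < x \<Longrightarrow> 0 \<le> nu x"
    and top: "filterlim nu at_top (at_right 0)"
    and sv: "slowly_varying_at_0 l"
    and dH: "\<forall>lam>0. ((\<lambda>x. (nu (lam * x) - nu x) / l x) \<longlongrightarrow> c * ln lam) (at_right 0)"
  shows "(\<lambda>n. (\<integral>y. occupancy_kernel n y * nu (y / real n) \<partial>lborel)
             - (nu (1 / real n) - c * euler_mascheroni * l (1 / real n)))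
         \<in> o(\<lambda>n. l (1 / real n))"
proof -
  obtain C where C: "0 \<le> C" "eventually (\<lambda>x. \<forall>y>0. \<bar>nu (y * x) - nu x\<bar> \<le> C * (sqrt y + 1 / sqrt y) * \<bar>l x\<bar>) (at_right 0)"
    using de_haan_global_bound[OF mono nonneg top sv dH] by blast
  have lim0: "filterlim (\<lambda>n. 1 / real n) (at_right 0) sequentially"
    using filterlim_compose[OF filterlim_inverse_at_right_top filterlim_real_sequentially]
    by (simp add: inverse_eq_divide)
  \<comment> \<open>The de Haan quotient at \<open>x = 1 / n\<close> with dilation factor
    \<open>y\<close>, minus its limit.\<close>
  define q where "q n y = (nu (y / real n) - nu (1 / real n)) / l (1 / real n) - c * ln y" for n y
  define J where "J n = (\<integral>y. occupancy_kernel n y * q n y \<partial>lborel)" for n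
  have q_meas [measurable]: "q n \<in> borel_measurable borel" for n unfolding q_def by measurable
  have nz: "eventually (\<lambda>n. l (1 / real n) \<noteq> 0) sequentially"
    using eventually_compose_filterlim[OF slowly_varying_at_0_nonzero[OF sv] lim0] .
  have "eventually (\<lambda>n. 2 \<le> n \<and> l (1 / real n) \<noteq> 0 \<and> (\<forall>y>0. \<bar>nu (y * (1 / real n)) - nu (1 / real n)\<bar> \<le> C * (sqrt y + 1 / sqrt y) * \<bar>l (1 / real n)\<bar>)) sequentially"
    using eventually_compose_filterlim[OF C(2) lim0] nz
    by (intro eventually_conj eventually_ge_at_top)
  then obtain N where N: "\<And>n. N \<le> n \<Longrightarrow> 2 \<le> n \<and> l (1 / real n) \<noteq> 0 \<and> (\<forall>y>0. \<bar>nu (y * (1 / real n)) - nu (1 / real n)\<bar> \<le> C * (sqrt y + 1 / sqrt y) * \<bar>l (1 / real n)\<bar>)"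
    unfolding eventually_sequentially by blast
  have q_bound: "\<bar>q n y\<bar> \<le> (C + 2 * \<bar>c\<bar>) * (sqrt y + 1 / sqrt y)" if "N \<le> n" "0 < y" for n y
  proof -
    have "\<bar>nu (y / real n) - nu (1 / real n)\<bar> / \<bar>l (1 / real n)\<bar> \<le> C * (sqrt y + 1 / sqrt y)"
      using N[OF that(1)] that(2) by (simp add: pos_divide_le_eq)
    moreover have "\<bar>c * ln y\<bar> \<le> \<bar>c\<bar> * (2 * (sqrt y + 1 / sqrt y))"
      unfolding abs_mult using that(2) by (intro mult_left_mono abs_ln_le_sqrt) auto
    ultimately have "\<bar>q n y\<bar> \<le> C * (sqrt y + 1 / sqrt y) + \<bar>c\<bar> * (2 * (sqrt y + 1 / sqrt y))"
      unfolding q_def by (intro order_trans[OF abs_triangle_ineq4] add_mono) (simp_all only: abs_divide)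
    then show ?thesis by (simp add: algebra_simps)
  qed
  have dom: "\<bar>occupancy_kernel n y * q n y\<bar> \<le> (C + 2 * \<bar>c\<bar>) * sqrt_envelope y" if "N \<le> n" for n y
    using N[OF that] C(1) q_bound[OF that] by (intro occupancy_kernel_times_le) auto
  have env: "integrable lborel (\<lambda>y. (C + 2 * \<bar>c\<bar>) * sqrt_envelope y)"
    using sqrt_envelope_integrable by simp
  have lim_q: "(\<lambda>n. occupancy_kernel n y * q n y) \<longlonglongrightarrow> 0" for y
  proof (cases "0 < y")
    case True
    have "(\<lambda>n. (nu (y * (1 / real n)) - nu (1 / real n)) / l (1 / real n)) \<longlonglongrightarrow> c * ln y"
      using filterlim_compose[OF dH[rule_format, OF True] lim0] .
    from tendsto_diff[OF this tendsto_const[of "c * ln y"]]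
    have "(\<lambda>n. q n y) \<longlonglongrightarrow> 0" by (simp add: q_def)
    then have "(\<lambda>n. \<bar>q n y\<bar>) \<longlonglongrightarrow> 0" by (rule tendsto_rabs_zero)
    then show ?thesis
    proof (rule Lim_null_comparison[rotated], intro always_eventually allI)
      fix n
      have "occupancy_kernel n y \<le> 1"
        using True by (auto simp: occupancy_kernel_def intro!: power_le_one)
      then show "norm (occupancy_kernel n y * q n y) \<le> \<bar>q n y\<bar>"
        by (simp add: abs_mult mult_left_le_one_le)
    qed
  qed (simp add: occupancy_kernel_def)
  \<comment> \<open>The shift by \<open>N\<close> makes the majorant valid for every term of the
    sequence.\<close>
  have "(\<lambda>i. J (i + N)) \<longlonglongrightarrow> (\<integral>y. 0 \<partial>(lborel :: real measure))"
    unfolding J_def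
  proof (rule integral_dominated_convergence[OF _ _ env])
    show "AE y in lborel. (\<lambda>i. occupancy_kernel (i + N) y * q (i + N) y) \<longlonglongrightarrow> 0"
      using LIMSEQ_ignore_initial_segment[OF lim_q] by (intro AE_I2)
    show "AE y in lborel. norm (occupancy_kernel (i + N) y * q (i + N) y) \<le> (C + 2 * \<bar>c\<bar>) * sqrt_envelope y" for i
      using dom by (intro AE_I2) simp
  qed measurable
  then have J: "J \<longlonglongrightarrow> 0" by (intro LIMSEQ_offset[of J N]) simp
  \<comment> \<open>Solving the definition of \<open>q\<close> for \<open>nu (y / n)\<close> and
    integrating yields the error \<open>J n\<close>, the logarithmic moment and the mass 1.
    Integrability of the left-hand integrand comes from these three summands.\<close>
  have E: "(\<integral>y. occupancy_kernel n y * nu (y / real n) \<partial>lborel)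
      = l (1 / real n) * J n + c * l (1 / real n) * (ln (real n) - harm n) + nu (1 / real n)" if n: "N \<le> n" for n
  proof -
    have n2: "2 \<le> n" and ln0: "l (1 / real n) \<noteq> 0" using N[OF n] by auto
    have int: "integrable lborel (\<lambda>y. occupancy_kernel n y * q n y)"
      using dom[OF n] by (intro Bochner_Integration.integrable_bound[OF env] AE_I2)
        (auto intro: order_trans[OF _ abs_ge_self])
    have "has_bochner_integral lborel (\<lambda>y. occupancy_kernel n y * indicator {..real n} y) 1"
      using has_bochner_integral_occupancy_kernel_atMost[of n "real n"] n2 by (simp add: zero_power)
    moreover have "(\<lambda>y. occupancy_kernel n y * indicator {..real n} y) = occupancy_kernel n"
      by (auto simp: occupancy_kernel_def indicator_def)
    ultimately have one: "has_bochner_integral lborel (occupancy_kernel n) 1" by simp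
    have "has_bochner_integral lborel (\<lambda>y. l (1 / real n) * (occupancy_kernel n y * q n y)
        + c * l (1 / real n) * (occupancy_kernel n y * ln y) + nu (1 / real n) * occupancy_kernel n y)
      (l (1 / real n) * J n + c * l (1 / real n) * (ln (real n) - harm n) + nu (1 / real n) * 1)"
      using has_bochner_integral_integrable[OF int] one
        has_bochner_integral_integrable[OF occupancy_kernel_ln_integral(2)[OF n2]]
      unfolding J_def occupancy_kernel_ln_integral(1)[OF n2, symmetric]
      by (intro has_bochner_integral_add has_bochner_integral_mult_right)
    moreover have "l (1 / real n) * (occupancy_kernel n y * q n y)
        + c * l (1 / real n) * (occupancy_kernel n y * ln y) + nu (1 / real n) * occupancy_kernel n y
        = occupancy_kernel n y * nu (y / real n)" for y
      using ln0 by (simp add: q_def field_simps)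
    ultimately show ?thesis by (simp add: has_bochner_integral_iff)
  qed
  \<comment> \<open>This is the deviation divided by \<open>l (1 / n)\<close>; the constant appears
    because \<open>harm n - ln n\<close> tends to \<open>euler_mascheroni\<close>.\<close>
  have "(\<lambda>n. J n + c * (euler_mascheroni - (harm n - ln (real n)))) \<longlonglongrightarrow> 0 + c * (euler_mascheroni - euler_mascheroni)"
    by (intro tendsto_intros J euler_mascheroni_LIMSEQ)
  then have lim: "(\<lambda>n. J n + c * (euler_mascheroni - (harm n - ln (real n)))) \<longlonglongrightarrow> 0" by simp
  show ?thesis
  proof (rule smalloI_tendsto[OF _ nz])
    show "(\<lambda>n. ((\<integral>y. occupancy_kernel n y * nu (y / real n) \<partial>lborel)
             - (nu (1 / real n) - c * euler_mascheroni * l (1 / real n))) / l (1 / real n)) \<longlonglongrightarrow> 0"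
    proof (rule Lim_transform_eventually[OF lim])
      show "\<forall>\<^sub>F n in sequentially. J n + c * (euler_mascheroni - (harm n - ln (real n)))
        = ((\<integral>y. occupancy_kernel n y * nu (y / real n) \<partial>lborel)
             - (nu (1 / real n) - c * euler_mascheroni * l (1 / real n))) / l (1 / real n)"
        using nz eventually_ge_at_top[of N] by eventually_elim (simp add: E field_simps)
    qed
  qed
qed

section \<open>Expected number of distinct values\<close>

lemma suminf_of_bool_ennreal:
  "(\<Sum>j. of_bool (P j) :: ennreal) = (if finite {j. P j} then of_nat (card {j. P j}) else top)"
proof -
  have "(\<Sum>j. of_bool (P j) :: ennreal) = (\<integral>\<^sup>+j. indicator {j. P j} j \<partial>count_space UNIV)"
    by (simp add: nn_integral_count_space_nat indicator_def of_bool_def)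
  also have "\<dots> = emeasure (count_space UNIV) {j. P j}"
    by (intro nn_integral_indicator) auto
  finally show ?thesis by (simp add: emeasure_count_space)
qed

text \<open>Infinite sets are covered too: \<open>card\<close> gives 0 there and
  \<open>enn2real top\<close> is 0. The shift by \<open>Suc\<close> moves indices from 1 on to all
  naturals.\<close>

lemma card_pos_eq_enn2real_suminf:
  "real (card {j. 1 \<le> j \<and> P j}) = enn2real (\<Sum>j. of_bool (P (Suc j)))"
proof -
  have "{j. 1 \<le> j \<and> P j} = Suc ` {j. P (Suc j)}"
    by (auto simp: image_iff Suc_le_eq gr0_conv_Suc)
  then have "card {j. 1 \<le> j \<and> P j} = card {j. P (Suc j)}"
    by (simp add: card_image)
  then show ?thesis
    unfolding suminf_of_bool_ennreal by (auto simp: ennreal_of_nat_eq_real_of_nat)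
qed

text \<open>Markov's inequality for counting: every counted term contributes at least
  \<open>x\<close> to the sum \<open>s\<close>.\<close>

lemma finite_ge_of_has_sum:
  fixes f :: "nat \<Rightarrow> real"
  assumes "(f has_sum s) A" "\<And>j. j \<in> A \<Longrightarrow> 0 \<le> f j" "0 < x"
  shows "finite {j \<in> A. x \<le> f j} \<and> card {j \<in> A. x \<le> f j} \<le> nat \<lfloor>s / x\<rfloor>"
proof (rule finite_if_finite_subsets_card_bdd)
  fix G assume G: "G \<subseteq> {j \<in> A. x \<le> f j}" "finite G"
  have "real (card G) * x = (\<Sum>j\<in>G. x)" by simp
  also have "\<dots> \<le> sum f G" using G by (intro sum_mono) auto
  also have "\<dots> \<le> s"
    using G assms by (intro has_sum_mono2[OF has_sum_finite[OF G(2)] assms(1)]) auto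
  finally show "card G \<le> nat \<lfloor>s / x\<rfloor>"
    using assms(3) by (simp add: le_nat_floor pos_le_divide_eq)
qed

section \<open>The tail mean measure of random frequencies\<close>

locale random_frequencies = prob_space M for M :: "'a measure" +
  fixes w :: "nat \<Rightarrow> 'a \<Rightarrow> real"
  assumes w_meas: "\<And>j. 1 \<le> j \<Longrightarrow> w j \<in> borel_measurable M"
    and w_range: "\<And>j \<omega>. 1 \<le> j \<Longrightarrow> \<omega> \<in> space M \<Longrightarrow> 0 < w j \<omega> \<and> w j \<omega> < 1"
    and w_sum: "AE \<omega> in M. ((\<lambda>j. w j \<omega>) has_sum 1) {1..}"
begin

lemma w_Suc_measurable [measurable]: "w (Suc j) \<in> borel_measurable M"
  by (rule w_meas) simp

text \<open>For \<open>x > 0\<close> the count is almost surely at most \<open>1 / x\<close>, so the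
  extended count loses nothing. For \<open>x \<le> 0\<close> every index counts and both sides are 0
  by convention; the formula for all \<open>x\<close> then gives measurability on the whole
  line.\<close>

lemma tail_mean_measure_eq:
  "tail_mean_measure M w x = enn2real (\<integral>\<^sup>+\<omega>. (\<Sum>j. of_bool (x \<le> w (Suc j) \<omega>)) \<partial>M)"
  and tail_finite: "0 < x \<Longrightarrow> (\<integral>\<^sup>+\<omega>. (\<Sum>j. of_bool (x \<le> w (Suc j) \<omega>)) \<partial>M) < top"
proof -
  let ?S = "\<lambda>\<omega>. (\<Sum>j. of_bool (x \<le> w (Suc j) \<omega>)) :: ennreal"
  have "tail_mean_measure M w x = (\<integral>\<omega>. enn2real (?S \<omega>) \<partial>M)"
    unfolding tail_mean_measure_def card_pos_eq_enn2real_suminf ..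
  also have "\<dots> = enn2real (\<integral>\<^sup>+\<omega>. ennreal (enn2real (?S \<omega>)) \<partial>M)"
    by (intro integral_eq_nn_integral) auto
  finally have eq: "tail_mean_measure M w x = enn2real (\<integral>\<^sup>+\<omega>. ennreal (enn2real (?S \<omega>)) \<partial>M)" .
  have bnd: "AE \<omega> in M. ?S \<omega> \<le> of_nat (nat \<lfloor>1 / x\<rfloor>)" if "0 < x"
    using w_sum AE_space
  proof eventually_elim
    case (elim \<omega>)
    have im: "{j \<in> {1..}. x \<le> w j \<omega>} = Suc ` {j. x \<le> w (Suc j) \<omega>}"
      by (auto simp: image_iff Suc_le_eq gr0_conv_Suc)
    have "finite {j \<in> {1..}. x \<le> w j \<omega>} \<and> card {j \<in> {1..}. x \<le> w j \<omega>} \<le> nat \<lfloor>1 / x\<rfloor>"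
      using elim w_range that by (intro finite_ge_of_has_sum) (auto intro: less_imp_le)
    then show ?case unfolding im by (simp add: suminf_of_bool_ennreal card_image finite_image_iff)
  qed
  show "(\<integral>\<^sup>+\<omega>. ?S \<omega> \<partial>M) < top" if "0 < x"
  proof -
    have "(\<integral>\<^sup>+\<omega>. ?S \<omega> \<partial>M) \<le> (\<integral>\<^sup>+\<omega>. of_nat (nat \<lfloor>1 / x\<rfloor>) \<partial>M)"
      by (intro nn_integral_mono_AE bnd that)
    also have "\<dots> < top" by (simp add: emeasure_space_1 ennreal_of_nat_eq_real_of_nat)
    finally show ?thesis .
  qed
  show "tail_mean_measure M w x = enn2real (\<integral>\<^sup>+\<omega>. ?S \<omega> \<partial>M)"
  proof (cases "0 < x")
    case True
    have "AE \<omega> in M. ennreal (enn2real (?S \<omega>)) = ?S \<omega>"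
      using bnd[OF True] by eventually_elim (auto intro!: ennreal_enn2real simp: less_top[symmetric] top_unique)
    then show ?thesis unfolding eq by (simp cong: nn_integral_cong_AE)
  next
    case False
    have "x \<le> w (Suc j) \<omega>" if "\<omega> \<in> space M" for \<omega> j
      using False w_range[of "Suc j", OF _ that] by simp
    then have "\<And>\<omega>. \<omega> \<in> space M \<Longrightarrow> ?S \<omega> = top" by (subst suminf_of_bool_ennreal) simp
    then show ?thesis unfolding eq by (simp cong: nn_integral_cong add: emeasure_space_1)
  qed
qed

lemma ennreal_tail_mean_measure:
  "0 < x \<Longrightarrow> ennreal (tail_mean_measure M w x) = (\<integral>\<^sup>+\<omega>. (\<Sum>j. of_bool (x \<le> w (Suc j) \<omega>)) \<partial>M)"
  using tail_finite[of x] by (simp add: tail_mean_measure_eq)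

lemma tail_mean_measure_nonneg: "0 \<le> tail_mean_measure M w x"
  by (simp add: tail_mean_measure_eq)

lemma tail_mean_measure_antimono:
  assumes "0 < x" "x \<le> y"
  shows "tail_mean_measure M w y \<le> tail_mean_measure M w x"
proof -
  have "ennreal (tail_mean_measure M w y) \<le> ennreal (tail_mean_measure M w x)"
    using assms by (auto simp: ennreal_tail_mean_measure intro!: nn_integral_mono suminf_le)
  then show ?thesis by (simp add: tail_mean_measure_nonneg)
qed

lemma tail_mean_measure_measurable [measurable]: "tail_mean_measure M w \<in> borel_measurable borel"
  unfolding tail_mean_measure_eq[abs_def] by measurable

text \<open>All frequencies are positive, so along \<open>x = 1 / (k + 1)\<close> each indicator
  increases to 1. By monotone convergence the expected counts increase to the number of indices,
  which is infinite.\<close>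

lemma tail_mean_measure_at_top: "filterlim (tail_mean_measure M w) at_top (at_right 0)"
  unfolding filterlim_at_top
proof
  fix Z
  let ?b = "\<lambda>k j \<omega>. of_bool (1 / real (Suc k) \<le> w (Suc j) \<omega>) :: ennreal"
  have inc: "incseq (\<lambda>k. ?b k j \<omega>)" for j \<omega>
  proof (rule incseq_SucI)
    fix k
    have "1 / real (Suc (Suc k)) \<le> 1 / real (Suc k)" by (intro divide_left_mono) auto
    then show "?b k j \<omega> \<le> ?b (Suc k) j \<omega>" by auto
  qed
  have SUP1: "(SUP k. ?b k j \<omega>) = 1" if \<omega>: "\<omega> \<in> space M" for j \<omega>
  proof (rule antisym)
    obtain k where "inverse (real (Suc k)) < w (Suc j) \<omega>"
      using reals_Archimedean[of "w (Suc j) \<omega>"] w_range[of "Suc j" \<omega>] \<omega> by auto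
    then have "?b k j \<omega> = 1" by (simp add: inverse_eq_divide)
    then show "1 \<le> (SUP k. ?b k j \<omega>)" by (intro SUP_upper2[of k]) simp_all
  qed (auto intro!: SUP_least)
  have "(SUP k. ennreal (tail_mean_measure M w (1 / real (Suc k)))) = (SUP k. \<integral>\<^sup>+\<omega>. (\<Sum>j. ?b k j \<omega>) \<partial>M)"
    by (simp add: ennreal_tail_mean_measure)
  also have "\<dots> = (\<integral>\<^sup>+\<omega>. (SUP k. \<Sum>j. ?b k j \<omega>) \<partial>M)"
    using inc by (intro nn_integral_monotone_convergence_SUP[symmetric])
      (auto simp: incseq_def le_fun_def intro!: suminf_le)
  also have "\<dots> = (\<integral>\<^sup>+\<omega>. (\<Sum>j. SUP k. ?b k j \<omega>) \<partial>M)"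
    by (intro nn_integral_cong ennreal_suminf_SUP_eq[symmetric] inc)
  also have "\<dots> = (\<integral>\<^sup>+\<omega>. (\<Sum>j::nat. of_bool True) \<partial>M)"
    by (intro nn_integral_cong) (simp only: SUP1 of_bool_eq)
  also have "\<dots> = top"
    unfolding suminf_of_bool_ennreal by (simp add: emeasure_space_1)
  finally have "(SUP k. ennreal (tail_mean_measure M w (1 / real (Suc k)))) = top" .
  \<comment> \<open>The maximum with 0 guards against \<open>ennreal\<close> truncating a negative
    \<open>Z\<close>.\<close>
  moreover have "ennreal (max 0 Z) < top" by simp
  ultimately have "ennreal (max 0 Z) < (SUP k. ennreal (tail_mean_measure M w (1 / real (Suc k))))" by (simp only:)
  then obtain k where k: "ennreal (max 0 Z) < ennreal (tail_mean_measure M w (1 / real (Suc k)))"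
    unfolding less_SUP_iff by blast
  then have "Z \<le> tail_mean_measure M w (1 / real (Suc k))"
    by (subst (asm) ennreal_less_iff) auto
  then have "Z \<le> tail_mean_measure M w x" if "0 < x" "x < 1 / real (Suc k)" for x
    using tail_mean_measure_antimono[of x "1 / real (Suc k)"] that by linarith
  moreover have "0 < 1 / real (Suc k)" by simp
  ultimately show "\<forall>\<^sub>F x in at_right 0. Z \<le> tail_mean_measure M w x"
    unfolding eventually_at_right_field by blast
qed

text \<open>By Tonelli, the term for index \<open>j\<close> integrates the kernel over
  \<open>y \<le> n * w j\<close>, which gives \<open>1 - (1 - w j) ^ n\<close>.\<close>

lemma nn_integral_occupancy_kernel_tail:
  assumes n: "0 < n"
  shows "(\<integral>\<^sup>+y. ennreal (occupancy_kernel n y * tail_mean_measure M w (y / real n)) \<partial>lborel)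
       = (\<Sum>j. \<integral>\<^sup>+\<omega>. ennreal (1 - (1 - w (Suc j) \<omega>) ^ n) \<partial>M)"
proof -
  interpret lborel_M: pair_sigma_finite lborel M ..
  have "(\<integral>\<^sup>+y. ennreal (occupancy_kernel n y * tail_mean_measure M w (y / real n)) \<partial>lborel)
      = (\<integral>\<^sup>+y. \<integral>\<^sup>+\<omega>. (\<Sum>j. ennreal (occupancy_kernel n y) * of_bool (y / real n \<le> w (Suc j) \<omega>)) \<partial>M \<partial>lborel)"
  proof (rule nn_integral_cong)
    fix y
    show "ennreal (occupancy_kernel n y * tail_mean_measure M w (y / real n))
      = (\<integral>\<^sup>+\<omega>. (\<Sum>j. ennreal (occupancy_kernel n y) * of_bool (y / real n \<le> w (Suc j) \<omega>)) \<partial>M)"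
    proof (cases "0 < y")
      case True
      then show ?thesis
        using n by (simp add: ennreal_mult' ennreal_tail_mean_measure nn_integral_cmult)
    qed (simp add: occupancy_kernel_def)
  qed
  also have "\<dots> = (\<integral>\<^sup>+\<omega>. \<integral>\<^sup>+y. (\<Sum>j. ennreal (occupancy_kernel n y) * of_bool (y / real n \<le> w (Suc j) \<omega>)) \<partial>lborel \<partial>M)"
    by (rule lborel_M.Fubini'[symmetric]) measurable
  also have "\<dots> = (\<integral>\<^sup>+\<omega>. (\<Sum>j. \<integral>\<^sup>+y. ennreal (occupancy_kernel n y) * of_bool (y / real n \<le> w (Suc j) \<omega>) \<partial>lborel) \<partial>M)"
    by (intro nn_integral_cong nn_integral_suminf) measurable
  also have "\<dots> = (\<integral>\<^sup>+\<omega>. (\<Sum>j. ennreal (1 - (1 - w (Suc j) \<omega>) ^ n)) \<partial>M)"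
  proof (intro nn_integral_cong suminf_cong)
    fix \<omega> j assume \<omega>: "\<omega> \<in> space M"
    let ?a = "real n * w (Suc j) \<omega>"
    have a: "0 \<le> ?a" "?a \<le> real n" using w_range[of "Suc j" \<omega>] \<omega> n by (auto simp: mult_le_cancel_left1)
    have "(\<integral>\<^sup>+y. ennreal (occupancy_kernel n y) * of_bool (y / real n \<le> w (Suc j) \<omega>) \<partial>lborel)
        = (\<integral>\<^sup>+y. ennreal (occupancy_kernel n y * indicator {..?a} y) \<partial>lborel)"
      using n by (intro nn_integral_cong) (auto simp: indicator_def field_simps)
    also have "\<dots> = ennreal (1 - (1 - ?a / real n) ^ n)"
      using has_bochner_integral_occupancy_kernel_atMost[OF n a]
      by (subst nn_integral_eq_integral) (auto simp: has_bochner_integral_iff)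
    finally show "(\<integral>\<^sup>+y. ennreal (occupancy_kernel n y) * of_bool (y / real n \<le> w (Suc j) \<omega>) \<partial>lborel)
       = ennreal (1 - (1 - w (Suc j) \<omega>) ^ n)" using n by simp
  qed
  also have "\<dots> = (\<Sum>j. \<integral>\<^sup>+\<omega>. ennreal (1 - (1 - w (Suc j) \<omega>) ^ n) \<partial>M)"
    by (intro nn_integral_suminf) measurable
  finally show ?thesis .
qed

text \<open>The total weight of the values allowed to a draw that avoids \<open>j\<close>, as a
  series over all naturals with zeros at the excluded values 0 and \<open>j\<close>.\<close>

lemma w_sums_without:
  assumes "1 \<le> j"
  shows "AE \<omega> in M. (\<lambda>k. if k = 0 \<or> k = j then 0 else w k \<omega>) sums (1 - w j \<omega>)"
  using w_sum
proof eventually_elim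
  case (elim \<omega>)
  have "((\<lambda>k. w k \<omega>) has_sum 1 - w j \<omega>) ({1..} - {j})"
    using assms by (intro has_sum_Diff[OF elim] has_sum_finiteI) auto
  then have "((\<lambda>k. if k = 0 \<or> k = j then 0 else w k \<omega>) has_sum 1 - w j \<omega>) UNIV"
    by (rule has_sum_cong_neutral[THEN iffD1, rotated -1]) auto
  then show ?case by (rule has_sum_imp_sums)
qed

end

section \<open>Sampling from the random frequencies\<close>

locale frequency_sample = random_frequencies M w for M :: "'a measure" and w +
  fixes X :: "nat \<Rightarrow> 'a \<Rightarrow> nat"
  assumes X_meas: "\<And>i. 1 \<le> i \<Longrightarrow> X i \<in> measurable M (count_space UNIV)"
    and X_pos: "\<And>i \<omega>. 1 \<le> i \<Longrightarrow> \<omega> \<in> space M \<Longrightarrow> 1 \<le> X i \<omega>"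
    and X_law: "\<And>n js. (\<forall>i\<in>{1..n}. 1 \<le> js i) \<Longrightarrow>
        prob {\<omega> \<in> space M. \<forall>i\<in>{1..n}. X i \<omega> = js i} = (\<integral>\<omega>. (\<Prod>i\<in>{1..n}. w (js i) \<omega>) \<partial>M)"
begin

lemma X_event_measurable [measurable]:
  assumes "1 \<le> i" shows "Measurable.pred M (\<lambda>\<omega>. X i \<omega> = k)"
  using X_meas[OF assms] by measurable

text \<open>
  Only the joint laws of whole prefixes are given, so the constraints \<open>X\<^sub>i \<noteq> j\<close> replace the constraints
  \<open>X\<^sub>i = js i\<close> one index at a time, summing over the value of \<open>X\<^sub>i\<close>.
\<close>
lemma prob_avoid_prefix:
  assumes j: "1 \<le> j"
  shows "m \<le> n \<Longrightarrow> \<forall>i\<in>{m<..n}. 1 \<le> js i \<Longrightarrow>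
    prob {\<omega> \<in> space M. (\<forall>i\<in>{1..m}. X i \<omega> \<noteq> j) \<and> (\<forall>i\<in>{m<..n}. X i \<omega> = js i)}
      = (\<integral>\<omega>. (1 - w j \<omega>) ^ m * (\<Prod>i\<in>{m<..n}. w (js i) \<omega>) \<partial>M)"
proof (induction m arbitrary: js)
  case 0
  have "{0<..n} = {1..n}" by auto
  then show ?case using X_law[of n js] 0 by simp
next
  case (Suc m)
  define E where "E js = {\<omega> \<in> space M. (\<forall>i\<in>{1..m}. X i \<omega> \<noteq> j) \<and> (\<forall>i\<in>{m<..n}. X i \<omega> = js i)}" for js
  define g where "g js \<omega> = (1 - w j \<omega>) ^ m * (\<Prod>i\<in>{m<..n}. w (js i) \<omega>)" for js \<omega>
  \<comment> \<open>\<open>F k\<close> fixes the value \<open>k\<close> for draw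
    \<open>Suc m\<close>, and \<open>f k\<close> is its integrand. Both vanish at 0, which is no
    value of a draw, and at \<open>j\<close>, which must be avoided.\<close>
  define F where "F k = (if k = 0 \<or> k = j then {} else E (js(Suc m := k)))" for k
  define f where "f k \<omega> = (if k = 0 \<or> k = j then 0 else g (js(Suc m := k)) \<omega>)" for k \<omega>
  define p where "p \<omega> = (\<Prod>i\<in>{Suc m<..n}. w (js i) \<omega>)" for \<omega>
  have ins: "{m<..n} = insert (Suc m) {Suc m<..n}" using Suc.prems by auto
  have E_sets: "E js \<in> sets M" for js
  proof -
    have [measurable]: "Measurable.pred M (\<lambda>\<omega>. X i \<omega> = k)" if "i \<in> {1..m} \<union> {m<..n}" for i k
      using that by (intro X_event_measurable) auto
    show ?thesis unfolding E_def by measurable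
  qed
  have F_sets: "range F \<subseteq> sets M" using E_sets by (auto simp: F_def)
  have ok: "\<forall>i\<in>{m<..n}. 1 \<le> (js(Suc m := k)) i" if "k \<noteq> 0" for k
    using that Suc.prems by (auto simp: ins)
  \<comment> \<open>The only dependence on \<open>k\<close> is the factor \<open>w k\<close>, so
    summation over \<open>k\<close> produces one more factor \<open>1 - w j\<close>.\<close>
  have g_eq: "g (js(Suc m := k)) \<omega> = w k \<omega> * ((1 - w j \<omega>) ^ m * p \<omega>)" for k \<omega>
    unfolding g_def ins p_def by (subst prod.insert) (auto intro!: prod.cong simp: mult_ac)
  have p01: "0 \<le> p \<omega>" "p \<omega> \<le> 1" if "\<omega> \<in> space M" for \<omega>
    unfolding p_def using Suc.prems w_range[OF _ that]
    by (auto intro!: prod_nonneg prod_le_1 intro: less_imp_le)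
  have p_meas [measurable]: "p \<in> borel_measurable M"
    unfolding p_def using Suc.prems w_meas by (intro borel_measurable_prod) auto
  have wj_meas [measurable]: "w j \<in> borel_measurable M" using j by (rule w_meas)
  have f01: "0 \<le> f k \<omega>" "f k \<omega> \<le> 1" if "\<omega> \<in> space M" for k \<omega>
    unfolding f_def g_eq using p01[OF that] w_range[OF j that] w_range[of k, OF _ that]
    by (auto intro!: mult_nonneg_nonneg mult_le_one power_le_one zero_le_power intro: less_imp_le)
  have f_int: "integrable M (f k)" for k
  proof (rule integrable_const_bound[of _ 1])
    show "AE \<omega> in M. norm (f k \<omega>) \<le> 1" using f01 by (intro AE_I2) auto
    show "f k \<in> borel_measurable M"
    proof (cases "k = 0")
      case False
      then have [measurable]: "w k \<in> borel_measurable M" by (intro w_meas) auto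
      show ?thesis unfolding f_def g_eq by measurable
    qed (simp add: f_def[abs_def])
  qed
  have F_prob: "prob (F k) = (\<integral>\<omega>. f k \<omega> \<partial>M)" for k
    using Suc.IH[OF _ ok[of k]] Suc.prems(1) by (auto simp: F_def f_def E_def g_def)
  have "disjoint_family F"
  proof (unfold disjoint_family_on_def, intro ballI impI)
    fix k k' :: nat assume "k \<noteq> k'"
    then show "F k \<inter> F k' = {}" by (auto simp: F_def E_def ins)
  qed
  with F_sets have "(\<lambda>k. prob (F k)) sums prob (\<Union>k. F k)" by (rule finite_measure_UNION)
  then have prob_sums: "(\<lambda>k. \<integral>\<omega>. f k \<omega> \<partial>M) sums prob (\<Union>k. F k)" unfolding F_prob .
  have f_sums: "AE \<omega> in M. (\<lambda>k. f k \<omega>) sums ((1 - w j \<omega>) ^ Suc m * p \<omega>)"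
    using w_sums_without[OF j]
  proof eventually_elim
    case (elim \<omega>)
    have "(\<lambda>k. (if k = 0 \<or> k = j then 0 else w k \<omega>) * ((1 - w j \<omega>) ^ m * p \<omega>)) = (\<lambda>k. f k \<omega>)"
      by (auto simp: f_def g_eq)
    with sums_mult2[OF elim, of "(1 - w j \<omega>) ^ m * p \<omega>"]
    show ?case by (simp add: mult.assoc)
  qed
  have "(\<lambda>k. \<integral>\<omega>. f k \<omega> \<partial>M) sums (\<integral>\<omega>. (\<Sum>k. f k \<omega>) \<partial>M)"
  proof (rule sums_integral[OF f_int])
    show "AE \<omega> in M. summable (\<lambda>k. norm (f k \<omega>))"
      using f_sums AE_space by eventually_elim (auto simp: f01 dest: sums_summable)
    have "(\<integral>\<omega>. norm (f k \<omega>) \<partial>M) = (\<integral>\<omega>. f k \<omega> \<partial>M)" for k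
      by (intro Bochner_Integration.integral_cong) (auto simp: f01)
    \<comment> \<open>Since \<open>f k\<close> is nonnegative, countable additivity of
      \<open>prob\<close> already supplies this summability.\<close>
    then show "summable (\<lambda>k. \<integral>\<omega>. norm (f k \<omega>) \<partial>M)" using prob_sums by (simp add: sums_summable)
  qed
  with prob_sums have "prob (\<Union>k. F k) = (\<integral>\<omega>. (\<Sum>k. f k \<omega>) \<partial>M)" by (rule sums_unique2)
  also have "\<dots> = (\<integral>\<omega>. (1 - w j \<omega>) ^ Suc m * p \<omega> \<partial>M)"
  proof (rule integral_cong_AE)
    show "AE \<omega> in M. (\<Sum>k. f k \<omega>) = (1 - w j \<omega>) ^ Suc m * p \<omega>"
      using f_sums by eventually_elim (simp add: sums_iff)
    show "(\<lambda>\<omega>. \<Sum>k. f k \<omega>) \<in> borel_measurable M"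
      using f_int by (intro borel_measurable_suminf) auto
  qed measurable
  also have "(\<Union>k. F k) = {\<omega> \<in> space M. (\<forall>i\<in>{1..Suc m}. X i \<omega> \<noteq> j) \<and> (\<forall>i\<in>{Suc m<..n}. X i \<omega> = js i)}"
    (is "_ = ?R")
  proof (intro equalityI subsetI)
    fix \<omega> assume "\<omega> \<in> (\<Union>k. F k)"
    then show "\<omega> \<in> ?R" by (auto simp: F_def E_def ins atLeastAtMostSuc_conv split: if_splits)
  next
    fix \<omega> assume \<omega>: "\<omega> \<in> ?R"
    \<comment> \<open>The observed value of draw \<open>Suc m\<close> is the witness;
      \<open>X_pos\<close> excludes 0.\<close>
    then have "\<omega> \<in> F (X (Suc m) \<omega>)"
      using X_pos[of "Suc m" \<omega>] by (auto simp: F_def E_def ins)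
    then show "\<omega> \<in> (\<Union>k. F k)" by blast
  qed
  finally show ?case unfolding p_def .
qed

lemma num_distinct_eq_suminf:
  assumes "\<omega> \<in> space M"
  shows "real (num_distinct X n \<omega>) = enn2real (\<Sum>j. of_bool (\<exists>i\<in>{1..n}. X i \<omega> = Suc j))" (is "_ = enn2real ?S")
    and "ennreal (real (num_distinct X n \<omega>)) = (\<Sum>j. of_bool (\<exists>i\<in>{1..n}. X i \<omega> = Suc j))"
proof -
  have "(\<lambda>i. X i \<omega>) ` {1..n} = {j. 1 \<le> j \<and> (\<exists>i\<in>{1..n}. X i \<omega> = j)}"
    using X_pos[OF _ assms] by auto
  then show eq: "real (num_distinct X n \<omega>) = enn2real ?S"
    unfolding num_distinct_def by (simp only: card_pos_eq_enn2real_suminf)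
  \<comment> \<open>Finitely many draws show finitely many values, so \<open>enn2real\<close> loses
    nothing.\<close>
  have "{j. \<exists>i\<in>{1..n}. X i \<omega> = Suc j} = Suc -` ((\<lambda>i. X i \<omega>) ` {1..n})" by force
  then have "finite {j. \<exists>i\<in>{1..n}. X i \<omega> = Suc j}" by (simp add: finite_vimageI)
  then have "?S < top" unfolding suminf_of_bool_ennreal by (simp add: ennreal_of_nat_eq_real_of_nat)
  then show "ennreal (real (num_distinct X n \<omega>)) = ?S" unfolding eq by simp
qed

text \<open>The count is a sum of indicators, one for each value, so its mean is the sum of the
  probabilities that a value is seen.\<close>

lemma nn_integral_num_distinct:
  "(\<integral>\<^sup>+\<omega>. ennreal (real (num_distinct X n \<omega>)) \<partial>M) = (\<Sum>j. \<integral>\<^sup>+\<omega>. ennreal (1 - (1 - w (Suc j) \<omega>) ^ n) \<partial>M)"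
proof -
  have [measurable]: "Measurable.pred M (\<lambda>\<omega>. X i \<omega> = k)" if "i \<in> {1..n}" for i k
    using that by (intro X_event_measurable) auto
  have "(\<integral>\<^sup>+\<omega>. ennreal (real (num_distinct X n \<omega>)) \<partial>M) = (\<integral>\<^sup>+\<omega>. (\<Sum>j. of_bool (\<exists>i\<in>{1..n}. X i \<omega> = Suc j)) \<partial>M)"
    by (intro nn_integral_cong num_distinct_eq_suminf(2))
  also have "\<dots> = (\<Sum>j. \<integral>\<^sup>+\<omega>. of_bool (\<exists>i\<in>{1..n}. X i \<omega> = Suc j) \<partial>M)"
    by (intro nn_integral_suminf) measurable
  also have "\<dots> = (\<Sum>j. \<integral>\<^sup>+\<omega>. ennreal (1 - (1 - w (Suc j) \<omega>) ^ n) \<partial>M)"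
  proof (rule suminf_cong)
    fix j
    let ?A = "{\<omega> \<in> space M. \<forall>i\<in>{1..n}. X i \<omega> \<noteq> Suc j}"
    have A: "?A \<in> sets M" by measurable
    have "\<bar>1 - w (Suc j) \<omega>\<bar> \<le> 1" if "\<omega> \<in> space M" for \<omega>
      using w_range[of "Suc j", OF _ that] by simp
    then have int: "integrable M (\<lambda>\<omega>. (1 - w (Suc j) \<omega>) ^ n)"
      by (intro integrable_const_bound[of _ 1] AE_I2) (auto simp: power_abs intro!: power_le_one)
    have "(\<integral>\<^sup>+\<omega>. of_bool (\<exists>i\<in>{1..n}. X i \<omega> = Suc j) \<partial>M) = (\<integral>\<^sup>+\<omega>. indicator (space M - ?A) \<omega> \<partial>M)"
      by (intro nn_integral_cong) (auto simp: indicator_def)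
    also have "\<dots> = ennreal (1 - prob ?A)"
      using A by (simp add: emeasure_eq_measure prob_compl)
    \<comment> \<open>The case \<open>m = n\<close> of \<open>prob_avoid_prefix\<close>: no equality
      constraints and no product remain.\<close>
    also have "1 - prob ?A = (\<integral>\<omega>. 1 - (1 - w (Suc j) \<omega>) ^ n \<partial>M)"
      using prob_avoid_prefix[of "Suc j" n n] int by (simp add: prob_space)
    also have "ennreal \<dots> = (\<integral>\<^sup>+\<omega>. ennreal (1 - (1 - w (Suc j) \<omega>) ^ n) \<partial>M)"
      using int w_range[of "Suc j"]
      by (intro nn_integral_eq_integral[symmetric] AE_I2) (auto intro!: power_le_one intro: less_imp_le)
    finally show "(\<integral>\<^sup>+\<omega>. of_bool (\<exists>i\<in>{1..n}. X i \<omega> = Suc j) \<partial>M)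
      = (\<integral>\<^sup>+\<omega>. ennreal (1 - (1 - w (Suc j) \<omega>) ^ n) \<partial>M)" .
  qed
  finally show ?thesis .
qed

lemma num_distinct_measurable: "(\<lambda>\<omega>. real (num_distinct X n \<omega>)) \<in> borel_measurable M"
proof -
  have [measurable]: "Measurable.pred M (\<lambda>\<omega>. X i \<omega> = k)" if "i \<in> {1..n}" for i k
    using that by (intro X_event_measurable) auto
  have "(\<lambda>\<omega>. enn2real (\<Sum>j. of_bool (\<exists>i\<in>{1..n}. X i \<omega> = Suc j))) \<in> borel_measurable M"
    by measurable
  then show ?thesis
    by (rule measurable_cong[THEN iffD2, rotated]) (rule num_distinct_eq_suminf(1))
qed

text \<open>Both Bochner integrals are \<open>enn2real\<close> of nonnegative integrals, which agree
  because they equal the same series.\<close>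

lemma expectation_num_distinct:
  assumes "0 < n"
  shows "(\<integral>\<omega>. real (num_distinct X n \<omega>) \<partial>M)
       = (\<integral>y. occupancy_kernel n y * tail_mean_measure M w (y / real n) \<partial>lborel)"
proof -
  have "(\<integral>\<omega>. real (num_distinct X n \<omega>) \<partial>M) = enn2real (\<integral>\<^sup>+\<omega>. ennreal (real (num_distinct X n \<omega>)) \<partial>M)"
    by (intro integral_eq_nn_integral num_distinct_measurable) auto
  also have "\<dots> = enn2real (\<integral>\<^sup>+y. ennreal (occupancy_kernel n y * tail_mean_measure M w (y / real n)) \<partial>lborel)"
    by (simp only: nn_integral_num_distinct nn_integral_occupancy_kernel_tail[OF assms])
  also have "\<dots> = (\<integral>y. occupancy_kernel n y * tail_mean_measure M w (y / real n) \<partial>lborel)"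
    by (intro integral_eq_nn_integral[symmetric]) (auto simp: tail_mean_measure_nonneg)
  finally show ?thesis .
qed

end

theorem theorem1:
  fixes M :: "'a measure" and w :: "nat \<Rightarrow> 'a \<Rightarrow> real" and X :: "nat \<Rightarrow> 'a \<Rightarrow> nat"
    and l :: "real \<Rightarrow> real" and c :: real
  assumes "prob_space M"
    and w_meas: "\<And>j. 1 \<le> j \<Longrightarrow> w j \<in> borel_measurable M"
    and w_range: "\<And>j \<omega>. 1 \<le> j \<Longrightarrow> \<omega> \<in> space M \<Longrightarrow> 0 < w j \<omega> \<and> w j \<omega> < 1"
    and w_sum: "AE \<omega> in M. ((\<lambda>j. w j \<omega>) has_sum 1) {1..}"
    and X_meas: "\<And>i. 1 \<le> i \<Longrightarrow> X i \<in> measurable M (count_space UNIV)"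
    and X_pos: "\<And>i \<omega>. 1 \<le> i \<Longrightarrow> \<omega> \<in> space M \<Longrightarrow> 1 \<le> X i \<omega>"
    and X_cond_iid: "\<And>n (js :: nat \<Rightarrow> nat) A. A \<in> freq_sigma M w \<Longrightarrow> (\<forall>i\<in>{1..n}. 1 \<le> js i) \<Longrightarrow>
        measure M (A \<inter> {\<omega> \<in> space M. \<forall>i\<in>{1..n}. X i \<omega> = js i})
          = (\<integral>\<omega>. indicator A \<omega> * (\<Prod>i\<in>{1..n}. w (js i) \<omega>) \<partial>M)"
    and l_sv: "slowly_varying_at_0 l"
    and c_nonneg: "c \<ge> 0"
    and nu_dH: "\<forall>lam>0. ((\<lambda>x. (tail_mean_measure M w (lam * x) - tail_mean_measure M w x) / l x)
                    \<longlongrightarrow> c * ln lam) (at_right 0)"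
  shows "(\<lambda>n. (\<integral>\<omega>. real (num_distinct X n \<omega>) \<partial>M)
               - (tail_mean_measure M w (1 / real n) - c * euler_mascheroni * l (1 / real n)))
         \<in> o(\<lambda>n. l (1 / real n))"
proof -
  interpret prob_space M by fact
  \<comment> \<open>The choice \<open>A = space M\<close> averages the conditional law over the
    frequencies and yields the joint laws of \<open>X_law\<close>.\<close>
  have "space M \<in> freq_sigma M w" unfolding freq_sigma_def by (rule sigma_sets_top)
  note law = X_cond_iid[OF this]
  interpret frequency_sample M w X
  proof (unfold_locales; (fact w_meas w_range w_sum X_meas X_pos)?)
    fix n :: nat and js :: "nat \<Rightarrow> nat" assume js: "\<forall>i\<in>{1..n}. 1 \<le> js i"
    have "space M \<inter> {\<omega> \<in> space M. \<forall>i\<in>{1..n}. X i \<omega> = js i} = {\<omega> \<in> space M. \<forall>i\<in>{1..n}. X i \<omega> = js i}" by blast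
    with law[of n js, OF js]
    have "prob {\<omega> \<in> space M. \<forall>i\<in>{1..n}. X i \<omega> = js i} = (\<integral>\<omega>. indicator (space M) \<omega> * (\<Prod>i\<in>{1..n}. w (js i) \<omega>) \<partial>M)"
      by simp
    also have "\<dots> = (\<integral>\<omega>. (\<Prod>i\<in>{1..n}. w (js i) \<omega>) \<partial>M)"
      by (intro Bochner_Integration.integral_cong) auto
    finally show "prob {\<omega> \<in> space M. \<forall>i\<in>{1..n}. X i \<omega> = js i} = (\<integral>\<omega>. (\<Prod>i\<in>{1..n}. w (js i) \<omega>) \<partial>M)" .
  qed
  \<comment> \<open>The formula for the mean is stated for \<open>n > 0\<close>; the asymptotic
    relation depends only on large \<open>n\<close>.\<close>
  have "eventually (\<lambda>n. (\<integral>y. occupancy_kernel n y * tail_mean_measure M w (y / real n) \<partial>lborel)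
             - (tail_mean_measure M w (1 / real n) - c * euler_mascheroni * l (1 / real n))
      = (\<integral>\<omega>. real (num_distinct X n \<omega>) \<partial>M)
             - (tail_mean_measure M w (1 / real n) - c * euler_mascheroni * l (1 / real n))) sequentially"
    using eventually_gt_at_top[of 0] by eventually_elim (simp add: expectation_num_distinct)
  then show ?thesis
    by (rule landau_o.small.in_cong[THEN iffD1])
       (intro de_haan_abelian_occupancy tail_mean_measure_measurable tail_mean_measure_antimono
         tail_mean_measure_nonneg tail_mean_measure_at_top l_sv nu_dH)
qed

end
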